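(* Let $f:\mathbb{R}\to\mathbb{R}$ be a $\mathcal{C}^\infty$ function all of whose derivatives grow at most polynomially at infinity, and suppose $f''>0$ on $\mathbb{R}$. Let $\mu\in(0,1]$ and let $p_1<p_2$ be finite real numbers. Let $u_0$ be a tempered distribution on $\mathbb{R}$ whose Fourier transform $\mathcal{F}u_0$ is a function with $\operatorname{supp}\mathcal{F}u_0=[p_1,p_2]$ and $$\mathcal{F}u_0(p)=(p-p_1)^{\mu-1}\,\tilde u(p)\qquad\text{for all }p\in(p_1,p_2],$$ where $\tilde u:[p_1,p_2]\to\mathbb{C}$ is continuous on $[p_1,p_2]$, differentiable on $(p_1,p_2)$ with $\tilde u'\in L^1(p_1,p_2)$, and $\tilde u(p_1)\neq0$ if $\mu\neq1$. Let $u$ be the solution of $[i\partial_t-f(D)]u=0$, $u(0,\cdot)=u_0$, given by $$u(t,x)=\frac{1}{2\pi}\int_{\mathbb{R}}\mathcal{F}u_0(p)\,e^{-itf(p)+ixp}\,dp ,\qquad t>0,\ x\in\mathbb{R}.$$ Let $\tilde p_1,\tilde p_2$ be finite real numbers with $\tilde p_1<p_1<p_2<\tilde p_2$. Then $$\forall\,(t,x)\in\mathfrak{C}\big(f'(\tilde p_1),f'(\tilde p_2)\big)\qquad |u(t,x)|\leqslant c(u_0,f)\,t^{-\frac{\mu}{2}},$$ where, with $m:=\min_{p\in[p_1,p_2]}f''(p)>0$, $$c(u_0,f):=\frac{1}{2\pi}\,\frac{3}{\mu}\,\|\tilde u\|_{L^\infty(p_1,p_2)}+\frac1\pi\Big(4\|\tilde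 u\|_{L^\infty(p_1,p_2)}+\|\tilde u'\|_{L^1(p_1,p_2)}\Big)m^{-1}.$$ Moreover $$\forall\,(t,x)\in\mathfrak{C}\big(f'(\tilde p_1),f'(\tilde p_2)\big)^c\qquad |u(t,x)|\leqslant c^c_{\tilde I}(u_0,f)\,t^{-\mu},$$ where, with $m_{\tilde p_1}:=f'(p_1)-f'(\tilde p_1)>0$ and $m_{\tilde p_2}:=f'(\tilde p_2)-f'(p_2)>0$, $$c^c_{\tilde I}(u_0,f):=\sum_{j=1}^{2}\left[\frac{1}{2\pi}\,\frac1\mu\,\|\tilde u\|_{L^\infty(p_1,p_2)}+\frac{1}{2\pi}\Big(4\|\tilde u\|_{L^\infty(p_1,p_2)}+\|\tilde u'\|_{L^1(p_1,p_2)}\Big)m_{\tilde p_j}^{-1}\right].$$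
   Context: Fourier transform convention: $\mathcal{F}v(p)=\int_{\mathbb{R}}v(x)e^{-ixp}\,dx$, extended to tempered distributions. $f(D)$ is the Fourier multiplier $f(D)v=\mathcal{F}^{-1}(f\,\mathcal{F}v)$. Under the hypotheses $\mathcal{F}u_0$ is integrable, so the formula for $u$ is well defined for all $t>0$, $x\in\mathbb{R}$. Space-time cones: for real $a<b$, $\mathfrak{C}(a,b):=\{(t,x)\in(0,+\infty)\times\mathbb{R} : a\leqslant \frac{x}{t}\leqslant b\}$ and $\mathfrak{C}(a,b)^c:=\big((0,+\infty)\times\mathbb{R}\big)\setminus\mathfrak{C}(a,b)$. Notation: $\tilde I:=[\tilde p_1,\tilde p_2]$. *)

theory Defs
  imports "HOL-Analysis.Analysis" "HOL-Probability.Essential_Supremum"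
    "HOL-Library.Landau_Symbols"
begin

section \<open>Smooth functions of polynomial growth\<close>

definition smooth_poly_growth :: "(real \<Rightarrow> real) \<Rightarrow> bool" where
  "smooth_poly_growth f \<longleftrightarrow>
     (\<forall>n. (deriv ^^ n) f differentiable_on UNIV) \<and>
     (\<forall>n. \<exists>N::nat. (deriv ^^ n) f \<in> O[at_infinity](\<lambda>x. x ^ N))"


section \<open>Schwartz functions, tempered distributions and their Fourier transforms\<close>

definition vderiv :: "(real \<Rightarrow> complex) \<Rightarrow> real \<Rightarrow> complex" where
  "vderiv \<phi> = (\<lambda>x. vector_derivative \<phi> (at x))"

definition schwartz :: "(real \<Rightarrow> complex) set" where
  "schwartz = {\<phi>. (\<forall>n. (vderiv ^^ n) \<phi> differentiable_on UNIV) \<and>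
                  (\<forall>k n. bounded (range (\<lambda>x. \<bar>x\<bar> ^ k * norm ((vderiv ^^ n) \<phi> x))))}"

definition schwartz_norm :: "nat \<Rightarrow> (real \<Rightarrow> complex) \<Rightarrow> real" where
  "schwartz_norm N \<phi> = (\<Sum>k\<le>N. \<Sum>n\<le>N. SUP x. \<bar>x\<bar> ^ k * norm ((vderiv ^^ n) \<phi> x))"

text \<open>
  A tempered distribution is a functional of which only the values on \<^const>\<open>schwartz\<close> matter.
  As the norms \<^const>\<open>schwartz_norm\<close> increase with the index and generate the
  Schwartz topology, continuity of a linear functional is domination by one of them.
\<close>

definition tempered_distribution :: "((real \<Rightarrow> complex) \<Rightarrow> complex) \<Rightarrow> bool" where
  "tempered_distribution T \<longleftrightarrow>
     (\<forall>\<phi>\<in>schwartz. \<forall>\<psi>\<in>schwartz. T (\<lambda>x. \<phi> x + \<psi> x) = T \<phi> + T \<psi>) \<and>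
     (\<forall>c. \<forall>\<phi>\<in>schwartz. T (\<lambda>x. c * \<phi> x) = c * T \<phi>) \<and>
     (\<exists>C N. \<forall>\<phi>\<in>schwartz. norm (T \<phi>) \<le> C * schwartz_norm N \<phi>)"

definition fourier :: "(real \<Rightarrow> complex) \<Rightarrow> real \<Rightarrow> complex" where
  "fourier v p = (LINT x|lborel. v x * exp (- \<i> * complex_of_real (x * p)))"

definition fourier_distr ::
    "((real \<Rightarrow> complex) \<Rightarrow> complex) \<Rightarrow> (real \<Rightarrow> complex) \<Rightarrow> complex" where
  "fourier_distr T = (\<lambda>\<phi>. T (fourier \<phi>))"

text \<open>The distribution \<open>T\<close> is (given by integration against) the function \<open>g\<close>.\<close>

definition distr_is_function ::
    "((real \<Rightarrow> complex) \<Rightarrow> complex) \<Rightarrow> (real \<Rightarrow> complex) \<Rightarrow> bool" where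
  "distr_is_function T g \<longleftrightarrow>
     (\<forall>\<phi>\<in>schwartz. integrable lborel (\<lambda>p. g p * \<phi> p) \<and>
                  T \<phi> = (LINT p|lborel. g p * \<phi> p))"

text \<open>
  A function representing a distribution is determined only almost everywhere, so its
  support is the complement of the largest open set on which it vanishes almost everywhere.
\<close>

definition ess_support :: "(real \<Rightarrow> complex) \<Rightarrow> real set" where
  "ess_support g = - \<Union>{U. open U \<and> (AE p in lborel. p \<in> U \<longrightarrow> g p = 0)}"


section \<open>Norms on an open interval\<close>

definition Linf_norm :: "real \<Rightarrow> real \<Rightarrow> (real \<Rightarrow> complex) \<Rightarrow> real" where
  "Linf_norm a b v =
     real_of_ereal (esssup (restrict_space lborel {a<..<b}) (\<lambda>p. ereal (norm (v p))))"

definition L1_norm :: "real \<Rightarrow> real \<Rightarrow> (real \<Rightarrow> complex) \<Rightarrow> real" where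
  "L1_norm a b v = (LINT p:{a<..<b}|lborel. norm (v p))"


section \<open>Space-time cones and the constants of the estimates\<close>

definition st_cone :: "real \<Rightarrow> real \<Rightarrow> (real \<times> real) set" where
  "st_cone a b = {(t, x). 0 < t \<and> a \<le> x / t \<and> x / t \<le> b}"

definition st_cone_compl :: "real \<Rightarrow> real \<Rightarrow> (real \<times> real) set" where
  "st_cone_compl a b = ({0<..} \<times> UNIV) - st_cone a b"

text \<open>
  In the constants below, \<open>v\<close> is the regular factor of the amplitude on \<open>[p1, p2]\<close>, while
  \<open>m\<close> and the two entries \<open>m1\<close>, \<open>m2\<close> are lower bounds coming from the phase.
\<close>

definition cone_const :: "real \<Rightarrow> real \<Rightarrow> real \<Rightarrow> (real \<Rightarrow> complex) \<Rightarrow> real \<Rightarrow> real" where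
  "cone_const \<mu> p1 p2 v m =
     1 / (2 * pi) * (3 / \<mu>) * Linf_norm p1 p2 v +
     1 / pi * (4 * Linf_norm p1 p2 v + L1_norm p1 p2 (vderiv v)) * inverse m"

definition cone_compl_const ::
    "real \<Rightarrow> real \<Rightarrow> real \<Rightarrow> (real \<Rightarrow> complex) \<Rightarrow> real \<Rightarrow> real \<Rightarrow> real" where
  "cone_compl_const \<mu> p1 p2 v m1 m2 =
     (\<Sum>m\<leftarrow>[m1, m2].
        1 / (2 * pi) * (1 / \<mu>) * Linf_norm p1 p2 v +
        1 / (2 * pi) * (4 * Linf_norm p1 p2 v + L1_norm p1 p2 (vderiv v)) * inverse m)"

end

theory Submission
  imports Defs
begin

text \<open>
  Up to the factor \<open>1 / (2 * pi)\<close>, \<open>u t x\<close> is an oscillatory integral with amplitude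
  \<open>(p - p1) powr (\<mu> - 1) * util p\<close> and phase derivative \<open>t * (x / t - f' p)\<close>. For a length \<open>d\<close>,
  the intervals of length \<open>d\<close> after the singularity \<open>p1\<close> and of radius \<open>d\<close> about the stationary
  point (if there is one) are estimated in absolute value and contribute \<open>d powr \<mu>\<close>; elsewhere
  one integrates by parts once. There the singular factor is at most \<open>d powr (\<mu> - 1)\<close>, and the
  reciprocal of the phase derivative is monotone because \<open>f'' > 0\<close>, so that its total variation is
  controlled by its size. Near a stationary point the phase derivative is at least \<open>t * m * d\<close>, and
  \<open>d = t powr (-1/2)\<close> balances both contributions; outside the cone it is at least \<open>t * m1\<close> or
  \<open>t * m2\<close>, and \<open>d = 1 / t\<close> does.
\<close>

section \<open>One integration by parts away from stationary points\<close>

lemma has_vector_derivative_cis: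
  assumes "(\<theta> has_real_derivative d) (at x)"
  shows "((\<lambda>x. cis (\<theta> x)) has_vector_derivative \<i> * of_real d * cis (\<theta> x)) (at x)"
proof -
  have "((\<lambda>x. complex_of_real (\<theta> x)) has_vector_derivative of_real d) (at x)"
    using assms by (intro has_vector_derivative_of_real) (simp add: has_real_derivative_iff_has_vector_derivative)
  then have "((\<lambda>x. \<i> * complex_of_real (\<theta> x)) has_vector_derivative \<i> * of_real d) (at x)"
    by (rule has_vector_derivative_mult_right)
  from field_vector_diff_chain_at[OF this DERIV_exp]
  show ?thesis
    by (simp add: o_def cis_conv_exp)
qed

text \<open>Integrate by parts, \<open>cis \<theta>\<close> being its own derivative divided by
  \<open>\<i> * \<theta>'\<close>. In units of \<open>A / L\<close>, the boundary terms contribute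
  \<open>g a + g b\<close>, the decrease of \<open>g\<close> contributes \<open>g a - g b\<close>,
  and the variation of \<open>1 / \<theta>'\<close> contributes \<open>g a\<close>: in total
  \<open>3 * g a\<close>. The derivative of \<open>v\<close> adds the integral term.\<close>

lemma nonstationary_phase_bound:
  fixes g g' \<theta> \<theta>' \<theta>'' :: "real \<Rightarrow> real" and v v' :: "real \<Rightarrow> complex"
  assumes ab: "a \<le> b" and L: "L > 0"
    and g: "\<And>p. p \<in> {a..b} \<Longrightarrow> (g has_real_derivative g' p) (at p)"
    and g_nonneg: "\<And>p. p \<in> {a..b} \<Longrightarrow> 0 \<le> g p"
    and g_decr: "\<And>p. p \<in> {a..b} \<Longrightarrow> g' p \<le> 0"
    and v_cont: "continuous_on {a..b} v"
    and v: "\<And>p. p \<in> {a<..<b} \<Longrightarrow> (v has_vector_derivative v' p) (at p)"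
    and v_bound: "\<And>p. p \<in> {a..b} \<Longrightarrow> norm (v p) \<le> A"
    and v'_int: "(\<lambda>p. norm (v' p)) integrable_on {a..b}"
    and \<theta>: "\<And>p. p \<in> {a..b} \<Longrightarrow> (\<theta> has_real_derivative \<theta>' p) (at p)"
    and \<theta>': "\<And>p. p \<in> {a..b} \<Longrightarrow> (\<theta>' has_real_derivative \<theta>'' p) (at p)"
    and \<theta>'': "\<And>p. p \<in> {a..b} \<Longrightarrow> \<theta>'' p \<le> 0"
    and sep: "(\<forall>p\<in>{a..b}. \<theta>' p \<ge> L) \<or> (\<forall>p\<in>{a..b}. \<theta>' p \<le> - L)"
  shows "norm (integral {a..b} (\<lambda>p. of_real (g p) * v p * cis (\<theta> p)))
           \<le> g a / L * (3 * A + integral {a..b} (\<lambda>p. norm (v' p)))"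
proof -
  \<comment> \<open>The derivative of \<open>F\<close> is \<open>R + G\<close>: differentiating the
    exponential gives back \<open>G\<close>, the other product rule terms form \<open>R\<close>.
    \<open>w'\<close> is the derivative of \<open>1 / \<theta>'\<close>.\<close>
  define k where "k = (\<lambda>p. g p / \<theta>' p)"
  define k' where "k' = (\<lambda>p. g' p / \<theta>' p - g p * \<theta>'' p / (\<theta>' p)\<^sup>2)"
  define w' where "w' = (\<lambda>p. - \<theta>'' p / (\<theta>' p)\<^sup>2)"
  define F where "F = (\<lambda>p. - \<i> * (of_real (k p) * v p * cis (\<theta> p)))"
  define R where "R = (\<lambda>p. - \<i> * ((of_real (k p) * v' p + of_real (k' p) * v p) * cis (\<theta> p)))"
  define G where "G = (\<lambda>p. of_real (g p) * v p * cis (\<theta> p))"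
  \<comment> \<open>A majorant of \<open>norm (R p)\<close> in which the signs of \<open>g'\<close>
    and \<open>\<theta>''\<close> are already used, so that its first two terms have explicit
    antiderivatives.\<close>
  define h where "h = (\<lambda>p. A * (- g' p / L + g a * w' p) + g a / L * norm (v' p))"
  have \<theta>'_abs: "L \<le> \<bar>\<theta>' p\<bar>" if "p \<in> {a..b}" for p
    using sep that by force
  then have \<theta>'_nz: "\<theta>' p \<noteq> 0" if "p \<in> {a..b}" for p
    using that L by force
  have A: "0 \<le> A"
    using order_trans[OF norm_ge_zero v_bound[of a]] ab by simp
  have g_cont: "continuous_on {a..b} g" and \<theta>_cont: "continuous_on {a..b} \<theta>"
    and \<theta>'_cont: "continuous_on {a..b} \<theta>'"
    using g \<theta> \<theta>' by (meson DERIV_isCont continuous_at_imp_continuous_on)+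
  have g_le: "g p \<le> g a" if "p \<in> {a..b}" for p
    using that by (intro DERIV_nonpos_imp_nonincreasing[of a p g]) (auto intro!: exI g g_decr)
  have inv_le: "1 / \<bar>\<theta>' p\<bar> \<le> 1 / L" if "p \<in> {a..b}" for p
    using \<theta>'_abs[OF that] L by (simp add: frac_le)
  have k_le: "\<bar>k p\<bar> \<le> g a / L" if "p \<in> {a..b}" for p
  proof -
    have "\<bar>k p\<bar> = g p * (1 / \<bar>\<theta>' p\<bar>)"
      using g_nonneg[OF that] by (simp add: k_def)
    also have "\<dots> \<le> g a * (1 / L)"
      using g_le[OF that] g_nonneg[OF that] inv_le[OF that] by (intro mult_mono) auto
    finally show ?thesis by simp
  qed
  have w'_nonneg: "0 \<le> w' p" if "p \<in> {a..b}" for p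
    using \<theta>''[OF that] by (simp add: w'_def divide_nonpos_nonneg)
  have k'_le: "\<bar>k' p\<bar> \<le> - g' p / L + g a * w' p" if "p \<in> {a..b}" for p
  proof -
    have "k' p = g' p / \<theta>' p + g p * w' p"
      by (simp add: k'_def w'_def)
    then have "\<bar>k' p\<bar> \<le> \<bar>g' p / \<theta>' p\<bar> + \<bar>g p * w' p\<bar>"
      by (simp only: abs_triangle_ineq)
    also have "\<dots> = - g' p * (1 / \<bar>\<theta>' p\<bar>) + g p * w' p"
      using g_decr[OF that] g_nonneg[OF that] w'_nonneg[OF that] by (simp add: abs_mult)
    also have "\<dots> \<le> - g' p * (1 / L) + g a * w' p"
      using g_decr[OF that] inv_le[OF that] w'_nonneg[OF that] g_le[OF that]
      by (intro add_mono mult_left_mono mult_right_mono) auto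
    finally show ?thesis by simp
  qed
  have k_deriv: "(k has_real_derivative k' p) (at p)" if "p \<in> {a..b}" for p
    unfolding k_def k'_def using \<theta>'_nz[OF that]
    by (auto intro!: derivative_eq_intros g[OF that] \<theta>'[OF that] simp: field_simps power2_eq_square)
  have F_deriv: "(F has_vector_derivative R p + G p) (at p)" if p: "p \<in> {a<..<b}" for p
  proof -
    have p': "p \<in> {a..b}" using p by auto
    have "((\<lambda>p. complex_of_real (k p)) has_vector_derivative of_real (k' p)) (at p)"
      using k_deriv[OF p'] by (intro has_vector_derivative_of_real) (simp add: has_real_derivative_iff_has_vector_derivative)
    note has_vector_derivative_mult_right[OF has_vector_derivative_mult[OF has_vector_derivative_mult[OF this v[OF p]]
      has_vector_derivative_cis[OF \<theta>[OF p']]], of "- \<i>"]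
    moreover have "complex_of_real (k p) * of_real (\<theta>' p) = of_real (g p)"
      using \<theta>'_nz[OF p'] by (simp add: k_def)
    then have "- \<i> * (of_real (k p) * v p * (\<i> * of_real (\<theta>' p) * cis (\<theta> p)) +
        (of_real (k p) * v' p + of_real (k' p) * v p) * cis (\<theta> p)) = R p + G p"
      unfolding R_def G_def by (simp add: algebra_simps)
    ultimately show ?thesis
      unfolding F_def by simp
  qed
  have k_cont: "continuous_on {a..b} k"
    unfolding k_def using \<theta>'_nz by (intro continuous_intros g_cont \<theta>'_cont) auto
  \<comment> \<open>\<open>v\<close> is differentiable in the interior only, hence the interior form
    of the fundamental theorem.\<close>
  have F_int: "((\<lambda>p. R p + G p) has_integral (F b - F a)) {a..b}"
    using ab F_deriv unfolding F_def
    by (intro fundamental_theorem_of_calculus_interior)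
       (auto intro!: continuous_intros v_cont \<theta>_cont k_cont)
  have G_int: "G integrable_on {a..b}"
    unfolding G_def by (intro integrable_continuous_real continuous_intros g_cont v_cont \<theta>_cont)
  \<comment> \<open>The assumption on \<open>v'\<close> concerns its norm only; integrability of
    \<open>R\<close> comes from that of \<open>R + G\<close> and of the continuous
    \<open>G\<close>.\<close>
  have R_int: "R integrable_on {a..b}"
    using integrable_diff[OF has_integral_integrable[OF F_int] G_int] by simp
  have "integral {a..b} R + integral {a..b} G = F b - F a"
    using integral_add[OF R_int G_int] integral_unique[OF F_int] by simp
  then have "integral {a..b} G = F b - F a - integral {a..b} R"
    by (simp add: algebra_simps)
  then have "norm (integral {a..b} G) = norm (F b - F a - integral {a..b} R)"
    by simp
  then have "norm (integral {a..b} G) \<le> norm (F b) + norm (F a) + norm (integral {a..b} R)"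
    using norm_triangle_ineq4[of "F b - F a" "integral {a..b} R"] norm_triangle_ineq4[of "F b" "F a"]
    by linarith
  moreover have "norm (F b) \<le> g b / L * A" "norm (F a) \<le> g a / L * A"
  proof -
    have "norm (F p) \<le> g p / L * A" if "p \<in> {a..b}" for p
    proof -
      have "norm (F p) = g p * (1 / \<bar>\<theta>' p\<bar>) * norm (v p)"
        using g_nonneg[OF that] by (simp add: F_def k_def norm_mult norm_divide)
      also have "\<dots> \<le> g p * (1 / L) * A"
        using g_nonneg[OF that] inv_le[OF that] v_bound[OF that] L
        by (intro mult_mono mult_nonneg_nonneg) auto
      finally show ?thesis by simp
    qed
    then show "norm (F b) \<le> g b / L * A" "norm (F a) \<le> g a / L * A"
      using ab by auto
  qed
  moreover have "norm (integral {a..b} R)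
      \<le> A * ((g a - g b) / L + g a / L) + g a / L * integral {a..b} (\<lambda>p. norm (v' p))"
  proof -
    have g'_int: "(g' has_integral (g b - g a)) {a..b}"
      using ab g by (intro fundamental_theorem_of_calculus)
        (auto simp: has_real_derivative_iff_has_vector_derivative[symmetric] intro: DERIV_subset)
    have w'_int: "(w' has_integral (1 / \<theta>' b - 1 / \<theta>' a)) {a..b}"
    proof (intro fundamental_theorem_of_calculus ab)
      fix p assume p: "p \<in> {a..b}"
      have "((\<lambda>p. 1 / \<theta>' p) has_real_derivative w' p) (at p within {a..b})"
        unfolding w'_def using \<theta>'_nz[OF p]
        by (auto intro!: derivative_eq_intros DERIV_subset[OF \<theta>'[OF p]] simp: field_simps power2_eq_square)
      then show "((\<lambda>p. 1 / \<theta>' p) has_vector_derivative w' p) (at p within {a..b})"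
        by (simp add: has_real_derivative_iff_has_vector_derivative)
    qed
    have h_int: "(h has_integral A * (- (g b - g a) / L + g a * (1 / \<theta>' b - 1 / \<theta>' a))
        + g a / L * integral {a..b} (\<lambda>p. norm (v' p))) {a..b}"
      unfolding h_def
      by (intro has_integral_add has_integral_mult_right has_integral_divide has_integral_neg
          g'_int w'_int integrable_integral v'_int)
    have R_le: "norm (R p) \<le> h p" if "p \<in> {a..b}" for p
    proof -
      have "norm (R p) = norm (of_real (k p) * v' p + of_real (k' p) * v p)"
        by (simp add: R_def norm_mult)
      also have "\<dots> \<le> \<bar>k p\<bar> * norm (v' p) + \<bar>k' p\<bar> * norm (v p)"
        using norm_triangle_ineq[of "of_real (k p) * v' p" "of_real (k' p) * v p"] by (simp add: norm_mult)
      also have "\<dots> \<le> g a / L * norm (v' p) + (- g' p / L + g a * w' p) * A"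
        using k_le[OF that] k'_le[OF that] v_bound[OF that] abs_ge_zero[of "k' p"]
        by (intro add_mono mult_mono) auto
      finally show ?thesis by (simp add: h_def mult.commute add.commute)
    qed
    have "norm (integral {a..b} R) \<le> integral {a..b} h"
      using R_int h_int R_le by (intro Henstock_Kurzweil_Integration.integral_norm_bound_integral) auto
    also have "\<dots> = A * (- (g b - g a) / L + g a * (1 / \<theta>' b - 1 / \<theta>' a))
        + g a / L * integral {a..b} (\<lambda>p. norm (v' p))"
      using h_int by (rule integral_unique)
    \<comment> \<open>Both reciprocals have the same sign and size at most \<open>1 / L\<close>, so
      their difference costs \<open>1 / L\<close> and not \<open>2 / L\<close>.\<close>
    also have "1 / \<theta>' b - 1 / \<theta>' a \<le> 1 / L"
      using sep
    proof
      assume pos: "\<forall>p\<in>{a..b}. L \<le> \<theta>' p"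
      then have "L \<le> \<theta>' a" "L \<le> \<theta>' b"
        using ab by auto
      then have "0 \<le> 1 / \<theta>' a" "1 / \<theta>' b \<le> 1 / L"
        using L by (auto intro!: frac_le)
      then show ?thesis by linarith
    next
      assume neg: "\<forall>p\<in>{a..b}. \<theta>' p \<le> - L"
      then have "L \<le> - \<theta>' a" "\<theta>' b \<le> - L"
        using ab by force+
      then have "1 / (- \<theta>' a) \<le> 1 / L" "1 / \<theta>' b \<le> 0"
        using L by (intro frac_le, auto simp: divide_le_0_iff)
      then show ?thesis
        using minus_divide_right[of 1 "\<theta>' a"] by linarith
    qed
    finally show ?thesis
      using A g_nonneg[of a] ab by (simp add: mult_left_mono diff_divide_distrib)
  qed
  ultimately have "norm (integral {a..b} G) \<le> g b / L * A + g a / L * A +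
      (A * ((g a - g b) / L + g a / L) + g a / L * integral {a..b} (\<lambda>p. norm (v' p)))"
    by linarith
  also have "\<dots> = g a / L * (3 * A + integral {a..b} (\<lambda>p. norm (v' p)))"
    using L by (simp add: field_simps)
  finally show ?thesis by (simp add: G_def)
qed

section \<open>Powers with an integrable singularity\<close>

text \<open>Subadditivity of the power: the fractions \<open>x / y\<close> and
  \<open>(y - x) / y\<close> lie in \<open>[0, 1]\<close>, add up to 1, and do not decrease when
  raised to the power \<open>\<mu>\<close>.\<close>

lemma powr_diff_le_powr_of_diff:
  fixes x y :: real
  assumes "0 \<le> x" "x \<le> y" "0 < \<mu>" "\<mu> \<le> 1"
  shows "y powr \<mu> - x powr \<mu> \<le> (y - x) powr \<mu>"
proof (cases "y = 0")
  case True
  then show ?thesis using assms by simp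
next
  case False
  with assms have y: "y > 0" by simp
  have *: "z \<le> z powr \<mu>" if "0 \<le> z" "z \<le> 1" for z :: real
    using powr_mono'[of \<mu> 1 z] that assms by simp
  have "1 = x / y + (y - x) / y"
    using y by (simp add: field_simps)
  also have "\<dots> \<le> (x / y) powr \<mu> + ((y - x) / y) powr \<mu>"
    using y assms by (intro add_mono *) auto
  also have "\<dots> = (x powr \<mu> + (y - x) powr \<mu>) / y powr \<mu>"
    using y assms by (simp add: powr_divide add_divide_distrib)
  finally show ?thesis
    using y by (simp add: le_divide_eq)
qed

lemma has_integral_powr_shift:
  fixes a b c \<mu> :: real
  assumes "c \<le> a" "a \<le> b" "0 < \<mu>"
  shows "((\<lambda>p. (p - c) powr (\<mu> - 1)) has_integral ((b - c) powr \<mu> - (a - c) powr \<mu>) / \<mu>) {a..b}"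
proof -
  have "((\<lambda>p. (p - c) powr (\<mu> - 1)) has_integral (b - c) powr \<mu> / \<mu> - (a - c) powr \<mu> / \<mu>) {a..b}"
  \<comment> \<open>If \<open>a = c\<close> and \<open>\<mu> < 1\<close>, the antiderivative is
    continuous but not differentiable at \<open>a\<close>.\<close>
  proof (intro fundamental_theorem_of_calculus_interior assms)
    show "continuous_on {a..b} (\<lambda>p. (p - c) powr \<mu> / \<mu>)"
      using assms by (intro continuous_intros continuous_on_powr') auto
    fix p assume "p \<in> {a<..<b}"
    with assms have "((\<lambda>p. (p - c) powr \<mu> / \<mu>) has_real_derivative (p - c) powr (\<mu> - 1)) (at p)"
      by (auto intro!: derivative_eq_intros simp: powr_diff)
    then show "((\<lambda>p. (p - c) powr \<mu> / \<mu>) has_vector_derivative (p - c) powr (\<mu> - 1)) (at p)"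
      by (simp add: has_real_derivative_iff_has_vector_derivative)
  qed
  then show ?thesis
    by (simp add: diff_divide_distrib)
qed

section \<open>Essential supremum and essential support\<close>

text \<open>For continuous \<open>v\<close> the points of the open interval violating the essential
  bound form an open null set, which is empty; continuity extends the bound to the
  endpoints.\<close>

lemma norm_le_Linf_norm:
  assumes cont: "continuous_on {a..b} v" and "a < b" and p: "p \<in> {a..b}"
  shows "norm (v p) \<le> Linf_norm a b v"
proof -
  let ?M = "restrict_space lborel {a<..<b}"
  let ?s = "esssup ?M (\<lambda>p. ereal (norm (v p)))"
  have cont': "continuous_on {a<..<b} (\<lambda>p. norm (v p))"
    by (intro continuous_intros continuous_on_subset[OF cont]) auto
  then have "(\<lambda>p. norm (v p)) \<in> borel_measurable (restrict_space borel {a<..<b})"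
    by (rule borel_measurable_continuous_on_restrict)
  then have "(\<lambda>p. norm (v p)) \<in> borel_measurable ?M"
    by (simp add: measurable_def sets_restrict_space space_restrict_space)
  then have meas: "(\<lambda>p. ereal (norm (v p))) \<in> borel_measurable ?M"
    by (rule borel_measurable_ereal)
  have "compact (v ` {a..b})"
    using cont by (intro compact_continuous_image) auto
  then obtain C where C: "\<And>q. q \<in> {a..b} \<Longrightarrow> norm (v q) \<le> C"
    by (meson bounded_iff compact_imp_bounded imageI)
  \<comment> \<open>\<open>?s\<close> must be shown finite, since \<open>real_of_ereal\<close> sends
    the infinities to 0.\<close>
  have "?s \<le> ereal C"
    by (rule esssup_I[OF meas]) (auto simp: AE_restrict_space_iff intro!: AE_I2 C)
  have AE: "AE q in lborel. q \<in> {a<..<b} \<longrightarrow> ereal (norm (v q)) \<le> ?s"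
    using esssup_AE[where M = ?M and f = "\<lambda>p. ereal (norm (v p))"]
    by (simp add: AE_restrict_space_iff)
  have inner: "ereal (norm (v q)) \<le> ?s" if q: "q \<in> {a<..<b}" for q
  proof (rule ccontr)
    assume less: "\<not> ereal (norm (v q)) \<le> ?s"
    define U where "U = {r \<in> {a<..<b}. ?s < ereal (norm (v r))}"
    have "continuous_on {a<..<b} (\<lambda>p. ereal (norm (v p)))"
      using cont' by (intro continuous_on_ereal)
    then have "open ((\<lambda>p. ereal (norm (v p))) -` {?s<..} \<inter> {a<..<b})"
      by (intro continuous_on_open_vimage[THEN iffD1, rule_format]) auto
    also have "(\<lambda>p. ereal (norm (v p))) -` {?s<..} \<inter> {a<..<b} = U"
      by (auto simp: U_def)
    finally have "open U" .
    moreover have "AE r in lborel. r \<notin> U"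
      using AE by eventually_elim (auto simp: U_def)
    then have "U \<in> null_sets lborel"
      using \<open>open U\<close> by (simp add: AE_iff_null_sets)
    then have "negligible U"
      by (simp add: negligible_iff_null_sets null_sets_completionI)
    moreover have "q \<in> U"
      using q less by (simp add: U_def)
    ultimately show False
      using open_not_negligible[of U] by auto
  qed
  have "ereal (norm (v ((a + b) / 2))) \<le> ?s"
    using \<open>a < b\<close> by (intro inner) auto
  with \<open>?s \<le> ereal C\<close> have s: "?s = ereal (Linf_norm a b v)"
    unfolding Linf_norm_def by (cases ?s) auto
  have "{a..b} = closure {a<..<b}"
    using \<open>a < b\<close> by simp
  with p have "p \<in> closure {a<..<b}" by simp
  then show ?thesis
    by (rule continuous_le_on_closure[rotated])
      (use cont \<open>a < b\<close> inner s in \<open>auto intro!: continuous_intros\<close>)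
qed

text \<open>The union defining the complement of the support may be uncountable; the Lindelof
  property reduces it to a countable one, over which the null sets can be united.\<close>

lemma AE_zero_outside_ess_support:
  "AE p in lborel. p \<notin> ess_support w \<longrightarrow> w p = 0"
proof -
  let ?F = "{U. open U \<and> (AE p in lborel. p \<in> U \<longrightarrow> w p = 0)}"
  obtain F' where F': "F' \<subseteq> ?F" "countable F'" "\<Union>F' = \<Union>?F"
    using Lindelof[of ?F] by auto
  have "AE p in lborel. \<forall>U\<in>F'. p \<in> U \<longrightarrow> w p = 0"
    using F' by (intro AE_ball_countable') auto
  moreover have "- ess_support w = \<Union>F'"
    by (simp add: ess_support_def F')
  ultimately show ?thesis
    by (auto elim!: eventually_mono)
qed

section \<open>The oscillatory integral with singular amplitude\<close>

text \<open>One point \<open>(t, x)\<close> is fixed. The amplitude enters the bounds only through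
  \<open>\<mu>\<close>, \<open>A\<close> and \<open>B\<close>, so the same constants serve every
  point.\<close>

locale singular_oscillatory_integral =
  fixes f f1 f2 :: "real \<Rightarrow> real" and \<mu> p1 p2 A t x :: real and v v' :: "real \<Rightarrow> complex"
  assumes \<mu>: "0 < \<mu>" "\<mu> \<le> 1" and p12: "p1 < p2" and t: "0 < t"
    and f: "\<And>p. (f has_real_derivative f1 p) (at p)"
    and f1: "\<And>p. (f1 has_real_derivative f2 p) (at p)"
    and f2: "\<And>p. f2 p \<ge> 0"
    and v_cont: "continuous_on {p1..p2} v"
    and v: "\<And>p. p \<in> {p1<..<p2} \<Longrightarrow> (v has_vector_derivative v' p) (at p)"
    and v_bound: "\<And>p. p \<in> {p1..p2} \<Longrightarrow> norm (v p) \<le> A"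
    and v'_int: "(\<lambda>p. norm (v' p)) integrable_on {p1..p2}"
begin

definition "B = integral {p1..p2} (\<lambda>p. norm (v' p))"
text \<open>At \<open>p1\<close> the convention \<open>0 powr y = 0\<close> makes the value 0; a
  single point does not affect the integral.\<close>

definition "\<Phi> = (\<lambda>p. of_real ((p - p1) powr (\<mu> - 1)) * v p * cis (x * p - t * f p))"

lemma A_nonneg: "0 \<le> A"
  using order_trans[OF norm_ge_zero v_bound[of p1]] p12 by simp

lemma B_nonneg: "0 \<le> B"
  unfolding B_def by (intro Henstock_Kurzweil_Integration.integral_nonneg v'_int) auto

lemma norm_\<Phi>_le: "p \<in> {p1..p2} \<Longrightarrow> norm (\<Phi> p) \<le> A * (p - p1) powr (\<mu> - 1)"
  using v_bound[of p] by (simp add: \<Phi>_def norm_mult mult.commute mult_right_mono)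

lemma f_cont: "continuous_on S f"
  using f by (meson DERIV_isCont continuous_at_imp_continuous_on)

lemma set_integrable_\<Phi>: "set_integrable lborel {p1..p2} \<Phi>"
proof -
  let ?g = "\<lambda>p. (p - p1) powr (\<mu> - 1)"
  have "(?g has_integral ((p2 - p1) powr \<mu> - (p1 - p1) powr \<mu>) / \<mu>) {p1..p2}"
    using p12 \<mu> by (intro has_integral_powr_shift) auto
  then have "?g absolutely_integrable_on {p1..p2}"
    by (intro nonnegative_absolutely_integrable_1) auto
  then have "integrable lborel (\<lambda>p. indicator {p1..p2} p *\<^sub>R ?g p)"
    unfolding set_integrable_def by (subst (asm) integrable_completion) auto
  then have bound: "integrable lborel (\<lambda>p. A * (indicator {p1..p2} p *\<^sub>R ?g p))"
    by (rule integrable_mult_right)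
  \<comment> \<open>Only the continuous factor is cut off by the indicator; the power, possibly
    discontinuous at \<open>p1\<close>, is Borel measurable on the whole line.\<close>
  have "(\<lambda>p. indicator {p1..p2} p *\<^sub>R (v p * cis (x * p - t * f p))) \<in> borel_measurable borel"
    by (intro borel_measurable_continuous_on_indicator continuous_intros v_cont f_cont) auto
  then have "(\<lambda>p. of_real (?g p) * (indicator {p1..p2} p *\<^sub>R (v p * cis (x * p - t * f p))))
      \<in> borel_measurable lborel"
    by measurable
  also have "(\<lambda>p. of_real (?g p) * (indicator {p1..p2} p *\<^sub>R (v p * cis (x * p - t * f p))))
      = (\<lambda>p. indicator {p1..p2} p *\<^sub>R \<Phi> p)"
    by (simp add: \<Phi>_def fun_eq_iff algebra_simps)
  finally show ?thesis
    unfolding set_integrable_def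
    by (rule Bochner_Integration.integrable_bound[OF bound])
      (use norm_\<Phi>_le A_nonneg in \<open>auto simp: indicator_def\<close>)
qed

lemma \<Phi>_integrable_on: "p1 \<le> a \<Longrightarrow> b \<le> p2 \<Longrightarrow> \<Phi> integrable_on {a..b}"
  using set_borel_integral_eq_integral(1)[OF set_integrable_\<Phi>]
  by (rule integrable_on_subinterval) auto

text \<open>By subadditivity of the power, the integral of the absolute value is controlled by the
  length alone, so the bound serves both next to \<open>p1\<close> and around a stationary
  point.\<close>

lemma norm_integral_\<Phi>_le_singular:
  assumes "p1 \<le> a" "a \<le> b" "b \<le> p2"
  shows "norm (integral {a..b} \<Phi>) \<le> A * (b - a) powr \<mu> / \<mu>"
proof -
  have I: "((\<lambda>p. A * (p - p1) powr (\<mu> - 1)) has_integral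
      A * (((b - p1) powr \<mu> - (a - p1) powr \<mu>) / \<mu>)) {a..b}"
    using assms \<mu> by (intro has_integral_mult_right has_integral_powr_shift) auto
  have "norm (integral {a..b} \<Phi>) \<le> integral {a..b} (\<lambda>p. A * (p - p1) powr (\<mu> - 1))"
    using assms I norm_\<Phi>_le
    by (intro Henstock_Kurzweil_Integration.integral_norm_bound_integral \<Phi>_integrable_on) auto
  also have "\<dots> = A * (((b - p1) powr \<mu> - (a - p1) powr \<mu>) / \<mu>)"
    using I by (rule integral_unique)
  also have "\<dots> \<le> A * ((b - a) powr \<mu> / \<mu>)"
    using powr_diff_le_powr_of_diff[of "a - p1" "b - p1" \<mu>] assms \<mu> A_nonneg
    by (intro mult_left_mono divide_right_mono) auto
  finally show ?thesis by simp
qed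

text \<open>At distance at least \<open>d\<close> from \<open>p1\<close> the decreasing singular
  factor is at most \<open>d powr (\<mu> - 1)\<close>, and the non-stationary estimate
  applies.\<close>

lemma norm_integral_\<Phi>_le_regular:
  assumes d: "0 < d" and ab: "p1 + d \<le> a" "a \<le> b" "b \<le> p2" and L: "0 < L"
    and sep: "(\<forall>p\<in>{a..b}. x - t * f1 p \<ge> L) \<or> (\<forall>p\<in>{a..b}. x - t * f1 p \<le> - L)"
  shows "norm (integral {a..b} \<Phi>) \<le> d powr (\<mu> - 1) / L * (4 * A + B)"
proof -
  have sub: "{a..b} \<subseteq> {p1..p2}" "{a<..<b} \<subseteq> {p1<..<p2}"
    using ab d by auto
  have v'_int': "(\<lambda>p. norm (v' p)) integrable_on {a..b}"
    using v'_int sub(1) by (rule integrable_on_subinterval)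
  have "norm (integral {a..b} \<Phi>)
      \<le> (a - p1) powr (\<mu> - 1) / L * (3 * A + integral {a..b} (\<lambda>p. norm (v' p)))"
    unfolding \<Phi>_def
  proof (rule nonstationary_phase_bound[where g' = "\<lambda>p. (\<mu> - 1) * (p - p1) powr (\<mu> - 2)"
        and \<theta>' = "\<lambda>p. x - t * f1 p" and \<theta>'' = "\<lambda>p. - t * f2 p"])
    show "((\<lambda>p. (p - p1) powr (\<mu> - 1)) has_real_derivative (\<mu> - 1) * (p - p1) powr (\<mu> - 2)) (at p)"
      if "p \<in> {a..b}" for p
    proof -
      have "((\<lambda>p. (p - p1) powr (\<mu> - 1)) has_real_derivative
          (\<mu> - 1) * (p - p1) powr (\<mu> - 1 - of_nat 1) * 1) (at p)"
        using that ab d by (intro DERIV_fun_powr) (auto intro!: derivative_eq_intros)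
      then show ?thesis by (simp add: algebra_simps)
    qed
    show "(\<mu> - 1) * (p - p1) powr (\<mu> - 2) \<le> 0" for p
      using \<mu> by (simp add: mult_nonpos_nonneg)
    show "((\<lambda>p. x * p - t * f p) has_real_derivative x - t * f1 p) (at p)" for p
      by (auto intro!: derivative_eq_intros f)
    show "((\<lambda>p. x - t * f1 p) has_real_derivative - t * f2 p) (at p)" for p
      by (auto intro!: derivative_eq_intros f1)
    show "- t * f2 p \<le> 0" for p
      using t f2[of p] by simp
  qed (use ab L sep sub v_bound v v'_int' continuous_on_subset[OF v_cont] in auto)
  \<comment> \<open>\<open>3 * A\<close> is relaxed to \<open>4 * A\<close>, the form used in the
    constants of the theorem.\<close>
  also have "\<dots> \<le> d powr (\<mu> - 1) / L * (4 * A + B)"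
  proof (intro mult_mono divide_right_mono add_mono)
    show "(a - p1) powr (\<mu> - 1) \<le> d powr (\<mu> - 1)"
      using \<mu> ab d by (intro powr_mono2') auto
    show "integral {a..b} (\<lambda>p. norm (v' p)) \<le> B"
      unfolding B_def using sub v'_int v'_int' by (intro integral_subset_le) auto
    show "0 \<le> 3 * A + integral {a..b} (\<lambda>p. norm (v' p))"
      using A_nonneg v'_int' by (intro add_nonneg_nonneg Henstock_Kurzweil_Integration.integral_nonneg) auto
  qed (use A_nonneg L in auto)
  finally show ?thesis .
qed

lemma norm_integral_\<Phi>_le_of_nonstationary:
  assumes c: "0 < c"
    and sep: "(\<forall>p\<in>{p1..p2}. x / t - f1 p \<ge> c) \<or> (\<forall>p\<in>{p1..p2}. x / t - f1 p \<le> - c)"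
  shows "norm (integral {p1..p2} \<Phi>) \<le> (A / \<mu> + (4 * A + B) / c) * t powr (- \<mu>)"
proof -
  define d where "d = 1 / t"
  \<comment> \<open>The minimum covers small \<open>t\<close>: if \<open>1 / t\<close> exceeds the
    length of the interval, the second piece degenerates to a point.\<close>
  define a where "a = min (p1 + d) p2"
  have d: "0 < d"
    using t by (simp add: d_def)
  then have a: "p1 \<le> a" "a \<le> p2" "a - p1 \<le> d"
    using p12 by (auto simp: a_def)
  have d_powr: "d powr \<mu> = t powr (- \<mu>)"
    using t by (simp add: d_def powr_divide powr_minus_divide)
  have "norm (integral {p1..a} \<Phi>) \<le> A * (a - p1) powr \<mu> / \<mu>"
    using a by (intro norm_integral_\<Phi>_le_singular) auto
  also have "\<dots> \<le> A * d powr \<mu> / \<mu>"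
    using a A_nonneg \<mu> by (intro divide_right_mono mult_left_mono powr_mono2) auto
  finally have 1: "norm (integral {p1..a} \<Phi>) \<le> A / \<mu> * t powr (- \<mu>)"
    by (simp add: d_powr)
  have 2: "norm (integral {a..p2} \<Phi>) \<le> (4 * A + B) / c * t powr (- \<mu>)"
  proof (cases "a = p2")
    case True
    then show ?thesis
      using A_nonneg B_nonneg c by simp
  next
    case False
    then have a_eq: "a = p1 + d"
      by (auto simp: a_def min_def split: if_splits)
    have eq: "x - t * f1 p = t * (x / t - f1 p)" for p
      using t by (simp add: field_simps)
    have "norm (integral {a..p2} \<Phi>) \<le> d powr (\<mu> - 1) / (t * c) * (4 * A + B)"
    proof (rule norm_integral_\<Phi>_le_regular)
      show "(\<forall>p\<in>{a..p2}. x - t * f1 p \<ge> t * c) \<or> (\<forall>p\<in>{a..p2}. x - t * f1 p \<le> - (t * c))"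
        using sep
      proof
        assume *: "\<forall>p\<in>{p1..p2}. x / t - f1 p \<ge> c"
        have "t * c \<le> x - t * f1 p" if "p \<in> {a..p2}" for p
          unfolding eq using * that a t by (intro mult_left_mono) auto
        then show ?thesis by blast
      next
        assume *: "\<forall>p\<in>{p1..p2}. x / t - f1 p \<le> - c"
        have "x - t * f1 p \<le> t * (- c)" if "p \<in> {a..p2}" for p
          unfolding eq using * that a t by (intro mult_left_mono) auto
        then show ?thesis by auto
      qed
    qed (use d a_eq a t c in auto)
    \<comment> \<open>Here \<open>t * d = 1\<close>.\<close>
    also have "d powr (\<mu> - 1) / (t * c) = t powr (- \<mu>) / c"
      using t d by (simp add: powr_diff d_powr) (simp add: d_def)
    finally show ?thesis by (simp add: mult.commute)
  qed
  have "integral {p1..p2} \<Phi> = integral {p1..a} \<Phi> + integral {a..p2} \<Phi>"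
    using a by (intro Henstock_Kurzweil_Integration.integral_combine[symmetric] \<Phi>_integrable_on) auto
  then show ?thesis
    using 1 2 norm_triangle_ineq[of "integral {p1..a} \<Phi>" "integral {a..p2} \<Phi>"]
    by (simp add: distrib_right)
qed

text \<open>If \<open>x / t\<close> is no value of \<open>f1\<close> on \<open>[p1, p2]\<close>, the endpoint nearer to stationarity replaces
  the stationary point.\<close>

lemma obtain_stationary_point:
  assumes m: "\<And>p. p \<in> {p1..p2} \<Longrightarrow> m \<le> f2 p"
  obtains c where "c \<in> {p1..p2}"
    "\<And>p. p \<in> {p1..<c} \<Longrightarrow> x / t - f1 p \<ge> m * (c - p)"
    "\<And>p. p \<in> {c<..p2} \<Longrightarrow> x / t - f1 p \<le> - (m * (p - c))"
proof -
  have growth: "m * (q - p) \<le> f1 q - f1 p" if "p1 \<le> p" "p \<le> q" "q \<le> p2" for p q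
  proof -
    have "f1 p - m * p \<le> f1 q - m * q"
    proof (rule DERIV_nonneg_imp_nondecreasing[OF \<open>p \<le> q\<close>])
      fix r assume "p \<le> r" "r \<le> q"
      then show "\<exists>y. ((\<lambda>p. f1 p - m * p) has_real_derivative y) (at r) \<and> 0 \<le> y"
        using that m[of r] by (auto intro!: exI[of _ "f2 r - m"] derivative_eq_intros f1)
    qed
    then show ?thesis by (simp add: algebra_simps)
  qed
  have f1_cont: "continuous_on {p1..p2} f1"
    using f1 by (meson DERIV_isCont continuous_at_imp_continuous_on)
  \<comment> \<open>\<open>f1 c <= x / t\<close> matters only for points left of \<open>c\<close>
    and \<open>x / t <= f1 c\<close> only for points right of it, so each may fail at the endpoint
    where that side is empty.\<close>
  have "\<exists>c\<in>{p1..p2}. (c = p1 \<or> f1 c \<le> x / t) \<and> (c = p2 \<or> x / t \<le> f1 c)"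
  proof (cases "x / t \<le> f1 p1 \<or> f1 p2 \<le> x / t")
    case True
    then show ?thesis using p12 by auto
  next
    case False
    then have "\<exists>c\<ge>p1. c \<le> p2 \<and> f1 c = x / t"
      using p12 by (intro IVT' f1_cont) auto
    then show ?thesis
      by (metis atLeastAtMost_iff order_refl)
  qed
  then obtain c where c: "c \<in> {p1..p2}" "c = p1 \<or> f1 c \<le> x / t" "c = p2 \<or> x / t \<le> f1 c"
    by blast
  show ?thesis
  proof
    show "x / t - f1 p \<ge> m * (c - p)" if "p \<in> {p1..<c}" for p
      using c growth[of p c] that by (cases "c = p1") auto
    show "x / t - f1 p \<le> - (m * (p - c))" if "p \<in> {c<..p2}" for p
      using c growth[of c p] that by (cases "c = p2") auto
  qed (use c in auto)
qed

text \<open>Four pieces: next to \<open>p1\<close>, left of \<open>c\<close>, around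
  \<open>c\<close>, right of \<open>c\<close>. The first and third, of lengths at most
  \<open>d\<close> and \<open>2 * d\<close>, give the factor \<open>3 = 1 + 2\<close> because
  \<open>2 powr \<mu> <= 2\<close>; each of the other two gives
  \<open>(4 * A + B) / m\<close>.\<close>

lemma norm_integral_\<Phi>_le:
  assumes "0 < m" and m: "\<And>p. p \<in> {p1..p2} \<Longrightarrow> m \<le> f2 p"
  shows "norm (integral {p1..p2} \<Phi>) \<le> (3 * A / \<mu> + 2 * (4 * A + B) / m) * t powr (- \<mu> / 2)"
proof -
  obtain c where c: "c \<in> {p1..p2}"
    and left: "\<And>p. p \<in> {p1..<c} \<Longrightarrow> x / t - f1 p \<ge> m * (c - p)"
    and right: "\<And>p. p \<in> {c<..p2} \<Longrightarrow> x / t - f1 p \<le> - (m * (p - c))"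
    using obtain_stationary_point[OF m] by blast
  define d where "d = t powr (- 1 / 2)"
  have d: "0 < d"
    using t by (simp add: d_def)
  \<comment> \<open>\<open>t * d^2 = 1\<close> is the purpose of \<open>d\<close>: dividing
    \<open>d powr (\<mu> - 1)\<close> by the phase bound \<open>t * m * d\<close> then leaves
    \<open>d powr \<mu> / m\<close>.\<close>
  have "t * (d * d) = t * t powr (- 1)"
    unfolding d_def powr_add[symmetric] by simp
  then have tdd: "t * (d * d) = 1"
    using t by (simp add: powr_minus)
  have d_powr: "d powr \<mu> = t powr (- \<mu> / 2)"
    by (simp add: d_def powr_powr)
  have "d powr (\<mu> - 1) / (t * (m * d)) = d powr \<mu> / ((t * (d * d)) * m)"
    using d by (simp add: powr_diff mult_ac)
  then have quot: "d powr (\<mu> - 1) / (t * (m * d)) = d powr \<mu> / m"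
    by (simp add: tdd)
  have L: "0 < t * (m * d)"
    using t d \<open>0 < m\<close> by simp
  have eq: "x - t * f1 p = t * (x / t - f1 p)" for p
    using t by (simp add: field_simps)
  have regular_nonneg: "0 \<le> (4 * A + B) / m * d powr \<mu>"
    using A_nonneg B_nonneg \<open>0 < m\<close> by simp
  \<comment> \<open>The truncations keep the cuts ordered wherever \<open>c\<close> lies; a missing
    piece becomes a single point.\<close>
  define a1 where "a1 = min (p1 + d) p2"
  define a2 where "a2 = max a1 (c - d)"
  define a3 where "a3 = min (c + d) p2"
  have a: "p1 \<le> a1" "a1 \<le> a2" "a2 \<le> a3" "a3 \<le> p2" "a1 - p1 \<le> d" "a3 - a2 \<le> 2 * d"
    using d p12 c by (auto simp: a1_def a2_def a3_def)

  have "norm (integral {p1..a1} \<Phi>) \<le> A * (a1 - p1) powr \<mu> / \<mu>"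
    using a by (intro norm_integral_\<Phi>_le_singular) auto
  also have "\<dots> \<le> A * d powr \<mu> / \<mu>"
    using a A_nonneg \<mu> by (intro divide_right_mono mult_left_mono powr_mono2) auto
  finally have 1: "norm (integral {p1..a1} \<Phi>) \<le> A / \<mu> * d powr \<mu>"
    by simp

  have 2: "norm (integral {a1..a2} \<Phi>) \<le> (4 * A + B) / m * d powr \<mu>"
  proof (cases "a1 = a2")
    case True
    then show ?thesis using regular_nonneg by simp
  next
    case False
    \<comment> \<open>A nondegenerate piece means that neither truncation is active.\<close>
    then have a_eq: "a1 = p1 + d" "a2 = c - d"
      using c d by (auto simp: a1_def a2_def min_def max_def split: if_splits)
    have "norm (integral {a1..a2} \<Phi>) \<le> d powr (\<mu> - 1) / (t * (m * d)) * (4 * A + B)"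
    proof (rule norm_integral_\<Phi>_le_regular)
      have "t * (m * d) \<le> x - t * f1 p" if p: "p \<in> {a1..a2}" for p
      proof -
        have "m * d \<le> m * (c - p)"
          using p a_eq \<open>0 < m\<close> by (intro mult_left_mono) auto
        also have "\<dots> \<le> x / t - f1 p"
          using p a_eq a d by (intro left) auto
        finally show ?thesis
          unfolding eq using t by (intro mult_left_mono) auto
      qed
      then show "(\<forall>p\<in>{a1..a2}. t * (m * d) \<le> x - t * f1 p) \<or>
          (\<forall>p\<in>{a1..a2}. x - t * f1 p \<le> - (t * (m * d)))"
        by blast
    qed (use d a_eq a L in auto)
    then show ?thesis
      unfolding quot by (simp add: mult.commute)
  qed

  have "norm (integral {a2..a3} \<Phi>) \<le> A * (a3 - a2) powr \<mu> / \<mu>"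
    using a by (intro norm_integral_\<Phi>_le_singular) auto
  also have "\<dots> \<le> A * (2 * d) powr \<mu> / \<mu>"
    using a A_nonneg \<mu> by (intro divide_right_mono mult_left_mono powr_mono2) auto
  also have "\<dots> \<le> A * (2 * d powr \<mu>) / \<mu>"
    using A_nonneg \<mu> d powr_mono[of \<mu> 1 2]
    by (intro divide_right_mono mult_left_mono) (auto simp: powr_mult)
  finally have 3: "norm (integral {a2..a3} \<Phi>) \<le> 2 * A / \<mu> * d powr \<mu>"
    by (simp add: mult_ac)

  have 4: "norm (integral {a3..p2} \<Phi>) \<le> (4 * A + B) / m * d powr \<mu>"
  proof (cases "a3 = p2")
    case True
    then show ?thesis using regular_nonneg by simp
  next
    case False
    then have a_eq: "a3 = c + d"
      by (auto simp: a3_def min_def split: if_splits)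
    have "norm (integral {a3..p2} \<Phi>) \<le> d powr (\<mu> - 1) / (t * (m * d)) * (4 * A + B)"
    proof (rule norm_integral_\<Phi>_le_regular)
      have "x - t * f1 p \<le> - (t * (m * d))" if p: "p \<in> {a3..p2}" for p
      proof -
        have "x / t - f1 p \<le> - (m * (p - c))"
          using p a_eq a d by (intro right) auto
        also have "\<dots> \<le> - (m * d)"
          using p a_eq \<open>0 < m\<close> by simp
        finally have "t * (x / t - f1 p) \<le> t * - (m * d)"
          using t by (intro mult_left_mono) auto
        then show ?thesis by (simp add: eq)
      qed
      then show "(\<forall>p\<in>{a3..p2}. t * (m * d) \<le> x - t * f1 p) \<or>
          (\<forall>p\<in>{a3..p2}. x - t * f1 p \<le> - (t * (m * d)))"
        by blast
    qed (use d a_eq a c L in auto)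
    then show ?thesis
      unfolding quot by (simp add: mult.commute)
  qed

  have split: "integral {p1..q} \<Phi> = integral {p1..r} \<Phi> + integral {r..q} \<Phi>"
    if "p1 \<le> r" "r \<le> q" "q \<le> p2" for q r
    using that by (intro Henstock_Kurzweil_Integration.integral_combine[symmetric] \<Phi>_integrable_on) auto
  have "integral {p1..p2} \<Phi> = integral {p1..a1} \<Phi> + integral {a1..a2} \<Phi> + integral {a2..a3} \<Phi>
      + integral {a3..p2} \<Phi>"
    using split[of a3 p2] split[of a2 a3] split[of a1 a2] a by simp
  also have "norm \<dots> \<le> A / \<mu> * d powr \<mu> + (4 * A + B) / m * d powr \<mu> + 2 * A / \<mu> * d powr \<mu>
      + (4 * A + B) / m * d powr \<mu>"
    by (intro norm_triangle_le add_mono 1 2 3 4 order_refl)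
  also have "\<dots> = (3 * A / \<mu> + 2 * (4 * A + B) / m) * d powr \<mu>"
    by (simp add: algebra_simps add_divide_distrib)
  finally show ?thesis by (simp add: d_powr)
qed

end

section \<open>From the oscillatory integral to the solution\<close>

theorem theorem2p3:
  fixes f :: "real \<Rightarrow> real"
    and \<mu> p1 p2 q1 q2 m m1 m2 :: real
    and u0 :: "(real \<Rightarrow> complex) \<Rightarrow> complex"
    and u0hat util :: "real \<Rightarrow> complex"
    and u :: "real \<Rightarrow> real \<Rightarrow> complex"
  assumes f_smooth: "smooth_poly_growth f"
    and f_convex: "\<forall>p. deriv (deriv f) p > 0"
    and mu: "\<mu> \<in> {0<..1}"
    and p12: "p1 < p2"
    and u0_tempered: "tempered_distribution u0"
    and u0hat: "distr_is_function (fourier_distr u0) u0hat"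
    and supp: "ess_support u0hat = {p1..p2}"
    and factor: "\<forall>p\<in>{p1<..p2}. u0hat p = complex_of_real ((p - p1) powr (\<mu> - 1)) * util p"
    and util_cont: "continuous_on {p1..p2} util"
    and util_diff: "\<forall>p\<in>{p1<..<p2}. util differentiable (at p)"
    and util_L1: "set_integrable lborel {p1<..<p2} (vderiv util)"
    and util_p1: "\<mu> \<noteq> 1 \<longrightarrow> util p1 \<noteq> 0"
    and u: "\<forall>t>0. \<forall>x. u t x = 1 / (2 * pi) *
              (LINT p|lborel. u0hat p *
                 exp (- \<i> * complex_of_real (t * f p) + \<i> * complex_of_real (x * p)))"
    and q12: "q1 < p1" "p2 < q2"
    and m: "m = (INF p\<in>{p1..p2}. deriv (deriv f) p)"
    and m1: "m1 = deriv f p1 - deriv f q1"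
    and m2: "m2 = deriv f q2 - deriv f p2"
  shows "m \<in> deriv (deriv f) ` {p1..p2} \<and> m > 0 \<and>
    (\<forall>(t, x) \<in> st_cone (deriv f q1) (deriv f q2).
       norm (u t x) \<le> cone_const \<mu> p1 p2 util m * t powr (- \<mu> / 2)) \<and>
    m1 > 0 \<and> m2 > 0 \<and>
    (\<forall>(t, x) \<in> st_cone_compl (deriv f q1) (deriv f q2).
       norm (u t x) \<le> cone_compl_const \<mu> p1 p2 util m1 m2 * t powr (- \<mu>))"
proof -
  have smooth: "(deriv ^^ n) f differentiable (at p)" for n p
    using f_smooth by (auto simp: smooth_poly_growth_def differentiable_on_def)
  have f1: "(f has_real_derivative deriv f p) (at p)" for p
    using smooth[of 0] by (simp add: DERIV_deriv_iff_real_differentiable)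
  have f2: "(deriv f has_real_derivative deriv (deriv f) p) (at p)" for p
    using smooth[of 1] by (simp add: DERIV_deriv_iff_real_differentiable)
  \<comment> \<open>Continuity on a compact interval turns the infimum \<open>m\<close> into a
    minimum, attained at \<open>r\<close>, and thus positive.\<close>
  have "continuous_on {p1..p2} (deriv (deriv f))"
    using smooth[of 2] by (intro continuous_at_imp_continuous_on)
      (simp add: numeral_2_eq_2 differentiable_imp_continuous_within)
  then obtain r where r: "r \<in> {p1..p2}" "\<And>p. p \<in> {p1..p2} \<Longrightarrow> deriv (deriv f) r \<le> deriv (deriv f) p"
    using continuous_attains_inf[of "{p1..p2}" "deriv (deriv f)"] p12 by auto
  have m_eq: "m = deriv (deriv f) r"
    unfolding m using r by (intro cInf_eq_minimum) auto
  then have m_pos: "0 < m"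
    using f_convex by simp
  have f'_less: "deriv f p < deriv f q" if "p < q" for p q
    by (rule DERIV_pos_imp_increasing[OF that]) (use f_convex in \<open>auto intro!: exI f2\<close>)
  have m12_pos: "0 < m1" "0 < m2"
    using f'_less q12 by (auto simp: m1 m2)

  let ?A = "Linf_norm p1 p2 util" and ?B = "L1_norm p1 p2 (vderiv util)"
  have "set_integrable lborel {p1<..<p2} (\<lambda>p. norm (vderiv util p))"
    using util_L1 by (rule set_integrable_norm)
  from set_borel_integral_eq_integral[OF this]
  have v'_int: "(\<lambda>p. norm (vderiv util p)) integrable_on {p1..p2}"
    and B_eq: "?B = integral {p1..p2} (\<lambda>p. norm (vderiv util p))"
    by (simp_all add: L1_norm_def integrable_on_Icc_iff_Ioo integral_open_interval_real)
  \<comment> \<open>The separation \<open>c\<close> stays universally quantified, to be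
    \<open>m1\<close> or \<open>m2\<close> later.\<close>
  have bounds: "0 \<le> ?A \<and> 0 \<le> ?B \<and>
      norm (u t x) \<le> 1 / (2 * pi) * ((3 * ?A / \<mu> + 2 * (4 * ?A + ?B) / m) * t powr (- \<mu> / 2)) \<and>
      (\<forall>c>0. (\<forall>p\<in>{p1..p2}. x / t - deriv f p \<ge> c) \<or> (\<forall>p\<in>{p1..p2}. x / t - deriv f p \<le> - c) \<longrightarrow>
        norm (u t x) \<le> 1 / (2 * pi) * ((?A / \<mu> + (4 * ?A + ?B) / c) * t powr (- \<mu>)))"
    if t: "0 < t" for t x
  proof -
    interpret singular_oscillatory_integral f "deriv f" "deriv (deriv f)" \<mu> p1 p2 ?A t x util "vderiv util"
    proof
      show "(util has_vector_derivative vderiv util p) (at p)" if "p \<in> {p1<..<p2}" for p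
        using util_diff that by (simp add: vderiv_def vector_derivative_works)
    qed (use mu p12 t f1 f2 f_convex util_cont v'_int norm_le_Linf_norm[OF util_cont p12]
        in \<open>auto intro: less_imp_le\<close>)
    have eq: "?B = B"
      by (simp add: B_eq B_def)
    let ?H = "\<lambda>p. u0hat p * exp (- \<i> * complex_of_real (t * f p) + \<i> * complex_of_real (x * p))"
    let ?\<Phi> = "\<lambda>p. indicator {p1..p2} p *\<^sub>R \<Phi> p"
    \<comment> \<open>The support condition gives 0 almost everywhere outside the interval;
      \<open>p1\<close> is removed because the factorization holds only to its right.\<close>
    have "AE p in lborel. ?H p = ?\<Phi> p"
      using AE_zero_outside_ess_support[of u0hat] AE_lborel_singleton[of p1]
    proof eventually_elim
      case (elim p)
      show ?case
      proof (cases "p \<in> {p1..p2}")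
        case True
        with elim have "p \<in> {p1<..p2}" by auto
        with factor have "u0hat p = of_real ((p - p1) powr (\<mu> - 1)) * util p" by blast
        moreover have "exp (- \<i> * complex_of_real (t * f p) + \<i> * complex_of_real (x * p)) = cis (x * p - t * f p)"
          by (simp add: cis_conv_exp algebra_simps)
        ultimately show ?thesis
          using True by (simp add: \<Phi>_def)
      qed (use elim supp in auto)
    qed
    \<comment> \<open>only an inequality: \<open>u0hat\<close> could be non-measurable on the null set where the two sides
      differ, and then the integral on the left is \<open>0\<close> by convention\<close>
    then have "norm (LINT p|lborel. ?H p) \<le> norm (LINT p|lborel. ?\<Phi> p)"
    proof (cases "?H \<in> borel_measurable lborel")
      case True
      with \<open>AE p in lborel. ?H p = ?\<Phi> p\<close> show ?thesis
        using set_integrable_\<Phi> unfolding set_integrable_def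
        by (intro eq_refl arg_cong[where f = norm] integral_cong_AE) auto
    next
      case False
      then have "\<not> integrable lborel ?H"
        using borel_measurable_integrable by blast
      then show ?thesis
        by (simp add: not_integrable_integral_eq)
    qed
    also have "(LINT p|lborel. ?\<Phi> p) = integral {p1..p2} \<Phi>"
      using set_borel_integral_eq_integral(2)[OF set_integrable_\<Phi>]
      by (simp add: set_lebesgue_integral_def)
    finally have le: "norm (u t x) \<le> 1 / (2 * pi) * norm (integral {p1..p2} \<Phi>)"
      using u t by (simp add: norm_mult norm_divide divide_right_mono)
    have le': "norm (u t x) \<le> 1 / (2 * pi) * K" if "norm (integral {p1..p2} \<Phi>) \<le> K" for K
      using le that by (rule order_trans[OF _ mult_left_mono]) simp
    show ?thesis
      unfolding eq
      by (intro conjI allI impI A_nonneg B_nonneg le' norm_integral_\<Phi>_le m_pos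
          norm_integral_\<Phi>_le_of_nonstationary) (use m_eq r in auto)
  qed
  have A: "0 \<le> ?A" and B: "0 \<le> ?B"
    using bounds[of 1] by auto

  have cone: "norm (u t x) \<le> cone_const \<mu> p1 p2 util m * t powr (- \<mu> / 2)" if "0 < t" for t x
  proof -
    \<comment> \<open>The two regular pieces turn \<open>1 / (2 * pi)\<close> into
      \<open>1 / pi\<close>.\<close>
    have "cone_const \<mu> p1 p2 util m = 1 / (2 * pi) * (3 * ?A / \<mu> + 2 * (4 * ?A + ?B) / m)"
      using m_pos mu by (simp add: cone_const_def field_simps)
    then show ?thesis
      using bounds[OF that, of x] by (simp add: mult.assoc)
  qed

  have compl: "norm (u t x) \<le> cone_compl_const \<mu> p1 p2 util m1 m2 * t powr (- \<mu>)"
    if "0 < t" and out: "x / t < deriv f q1 \<or> deriv f q2 < x / t" for t x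
  proof -
    let ?K = "\<lambda>c. 1 / (2 * pi) * (?A / \<mu> + (4 * ?A + ?B) / c)"
    have "a * (1 / \<mu>) * ?A + a * N * inverse c = a * (?A / \<mu> + N / c)" for a N c :: real
      by (simp add: distrib_left flip: divide_inverse)
    then have K: "cone_compl_const \<mu> p1 p2 util m1 m2 = ?K m1 + ?K m2"
      by (simp only: cone_compl_const_def list.map sum_list.Cons sum_list.Nil add_0_right)
    have K_nonneg: "0 \<le> ?K m1" "0 \<le> ?K m2"
      using A B m12_pos mu by simp_all
    have f'_mono: "deriv f p \<le> deriv f q" if "p \<le> q" for p q
      using f'_less[of p q] that by (cases "p = q") auto
    \<comment> \<open>By monotonicity of \<open>f'\<close>, \<open>m1\<close> separates the phase
      from stationarity on the left of the cone and \<open>m2\<close> on the right. Each side yields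
      one summand of the constant; the other is nonnegative.\<close>
    have "norm (u t x) \<le> ?K m1 * t powr (- \<mu>) \<or> norm (u t x) \<le> ?K m2 * t powr (- \<mu>)"
      using out
    proof
      assume "x / t < deriv f q1"
      then have "x / t - deriv f p \<le> - m1" if "p \<in> {p1..p2}" for p
        using f'_mono[of p1 p] that by (simp add: m1)
      then show ?thesis
        using bounds[OF \<open>0 < t\<close>, of x] m12_pos by (simp add: mult.assoc)
    next
      assume "deriv f q2 < x / t"
      then have "x / t - deriv f p \<ge> m2" if "p \<in> {p1..p2}" for p
        using f'_mono[of p p2] that by (simp add: m2)
      then show ?thesis
        using bounds[OF \<open>0 < t\<close>, of x] m12_pos by (simp add: mult.assoc)
    qed
    moreover have "?K m1 * t powr (- \<mu>) \<le> (?K m1 + ?K m2) * t powr (- \<mu>)"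
      "?K m2 * t powr (- \<mu>) \<le> (?K m1 + ?K m2) * t powr (- \<mu>)"
      using K_nonneg by (intro mult_right_mono; simp)+
    ultimately show ?thesis
      unfolding K by linarith
  qed

  show ?thesis
  proof (intro conjI)
    show "m \<in> deriv (deriv f) ` {p1..p2}"
      using m_eq r(1) by blast
    show "\<forall>(t, x)\<in>st_cone (deriv f q1) (deriv f q2).
        norm (u t x) \<le> cone_const \<mu> p1 p2 util m * t powr (- \<mu> / 2)"
      unfolding st_cone_def using cone by blast
    show "\<forall>(t, x)\<in>st_cone_compl (deriv f q1) (deriv f q2).
        norm (u t x) \<le> cone_compl_const \<mu> p1 p2 util m1 m2 * t powr (- \<mu>)"
    proof clarify
      fix t x assume "(t, x) \<in> st_cone_compl (deriv f q1) (deriv f q2)"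
      then have "0 < t" "x / t < deriv f q1 \<or> deriv f q2 < x / t"
        by (auto simp: st_cone_def st_cone_compl_def)
      then show "norm (u t x) \<le> cone_compl_const \<mu> p1 p2 util m1 m2 * t powr (- \<mu>)"
        by (rule compl)
    qed
  qed (use m_pos m12_pos in auto)
qed

end
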